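(* Let $\{Q_n\}_{n\in\mathbb N_0}$ be a sequence of matrix polynomials which is a sequence of orthogonal polynomials with respect to an irreducible matrix weight $W$ and also with respect to a matrix weight $V$, both with compact support. Then $V$ is a scalar multiple of $W$, i.e. $V=\lambda W$ (almost everywhere) for some $\lambda>0$.
   Context: A matrix weight of size $N$ on an interval $(a,b)\subseteq\mathbb R$ is an integrable function $W:(a,b)\to\mathrm{Mat}_N(\mathbb C)$ such that $W(x)$ is positive semidefinite for all $x\in(a,b)$, positive definite for almost every $x$, and with finite moments $\int_a^b x^nW(x)\,dx$ of all orders $n\ge0$; it is regarded as a function on $\mathbb R$ by extending it by zero. A sequence of orthogonal polynomials with respect to $W$ is a sequence $Q_n\in\mathrm{Mat}_N(\mathbb C)[x]$ with $Q_n$ of degree $n$ with nonsingular leading coefficient and $\int Q_n(x)W(x)Q_m(x)^*dx=0$ for $n\ne m$. Two matrix weights $W,W'$ of the same size on the same interval are equivalent if there is a nonsingular constant matrix $M$ with $W'(x)=MW(x)M^*$ for all $x$. A matrix weight is irreducible if it is not equivalent to a direct sum (block diagonal weight) of matrix weights of smaller size. Weights are identified when they agree almost everywhere, so "for all $x$" in the definition of equivalence is understood as "for almost every $x$". *)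

theory Defs
  imports "HOL-Analysis.Analysis" "Jordan_Normal_Form.Schur_Decomposition"
begin

text \<open>
  The order on \<^typ>\<open>complex\<close> is the one from \<^theory>\<open>HOL-Library.Complex_Order\<close>:
  \<open>0 \<le> z\<close> (resp. \<open>0 < z\<close>) says that \<open>z\<close> is real and nonnegative (resp. positive).
  The number \<open>(A *\<^sub>v v) \<bullet>c v\<close> is \<open>v\<^sup>* A v\<close>.
\<close>

definition pos_semidefinite :: "nat \<Rightarrow> complex mat \<Rightarrow> bool" where
  "pos_semidefinite N A \<longleftrightarrow> A \<in> carrier_mat N N \<and> mat_adjoint A = A \<and>
     (\<forall>v \<in> carrier_vec N. 0 \<le> (A *\<^sub>v v) \<bullet>c v)"

definition pos_definite :: "nat \<Rightarrow> complex mat \<Rightarrow> bool" where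
  "pos_definite N A \<longleftrightarrow> A \<in> carrier_mat N N \<and> mat_adjoint A = A \<and>
     (\<forall>v \<in> carrier_vec N. v \<noteq> 0\<^sub>v N \<longrightarrow> 0 < (A *\<^sub>v v) \<bullet>c v)"

definition mat_integral :: "nat \<Rightarrow> (real \<Rightarrow> complex mat) \<Rightarrow> complex mat" where
  "mat_integral N F = mat N N (\<lambda>(i, j). \<integral>x. F x $$ (i, j) \<partial>lebesgue)"

definition mat_integrable :: "nat \<Rightarrow> (real \<Rightarrow> complex mat) \<Rightarrow> bool" where
  "mat_integrable N F \<longleftrightarrow> (\<forall>i < N. \<forall>j < N. integrable lebesgue (\<lambda>x. F x $$ (i, j)))"

text \<open>
  A matrix weight is a function on all of \<open>\<real>\<close> that is zero outside its interval \<open>(a, b)\<close>, which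
  may be unbounded, so integrals over \<open>(a, b)\<close> are integrals over \<open>\<real>\<close>. Integrability of the
  weight itself is the case \<open>n = 0\<close> of the moment condition.
\<close>

definition matrix_weight :: "ereal \<Rightarrow> ereal \<Rightarrow> nat \<Rightarrow> (real \<Rightarrow> complex mat) \<Rightarrow> bool" where
  "matrix_weight a b N W \<longleftrightarrow> a < b \<and> 0 < N \<and>
     (\<forall>x. x \<in> einterval a b \<longrightarrow> pos_semidefinite N (W x)) \<and>
     (\<forall>x. x \<notin> einterval a b \<longrightarrow> W x = 0\<^sub>m N N) \<and>
     (AE x in lebesgue. x \<in> einterval a b \<longrightarrow> pos_definite N (W x)) \<and>
     (\<forall>n. mat_integrable N (\<lambda>x. complex_of_real (x ^ n) \<cdot>\<^sub>m W x))"

definition compact_support :: "nat \<Rightarrow> (real \<Rightarrow> complex mat) \<Rightarrow> bool" where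
  "compact_support N W \<longleftrightarrow> compact (closure {x. W x \<noteq> 0\<^sub>m N N})"

definition equivalent_weights ::
    "nat \<Rightarrow> (real \<Rightarrow> complex mat) \<Rightarrow> (real \<Rightarrow> complex mat) \<Rightarrow> bool" where
  "equivalent_weights N W W' \<longleftrightarrow>
     (\<exists>M \<in> carrier_mat N N. invertible_mat M \<and>
        (AE x in lebesgue. W' x = M * W x * mat_adjoint M))"

definition direct_sum :: "(real \<Rightarrow> complex mat) list \<Rightarrow> real \<Rightarrow> complex mat" where
  "direct_sum Ws x = diag_block_mat (map (\<lambda>w. w x) Ws)"

definition irreducible_weight ::
    "ereal \<Rightarrow> ereal \<Rightarrow> nat \<Rightarrow> (real \<Rightarrow> complex mat) \<Rightarrow> bool" where
  "irreducible_weight a b N W \<longleftrightarrow> matrix_weight a b N W \<and>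
     \<not> (\<exists>Ws. (\<forall>w \<in> set Ws. \<exists>n < N. matrix_weight a b n w) \<and>
            equivalent_weights N W (direct_sum Ws))"

text \<open>
  Elements of \<open>Mat\<^sub>N(\<complex>)[x]\<close> are represented as matrices with polynomial entries, the variable
  being evaluated at real points.
\<close>

definition mat_poly_eval :: "complex poly mat \<Rightarrow> real \<Rightarrow> complex mat" where
  "mat_poly_eval P x = map_mat (\<lambda>p. poly p (complex_of_real x)) P"

definition mat_poly_coeff :: "complex poly mat \<Rightarrow> nat \<Rightarrow> complex mat" where
  "mat_poly_coeff P k = map_mat (\<lambda>p. coeff p k) P"

definition orthogonal_polynomials ::
    "nat \<Rightarrow> (real \<Rightarrow> complex mat) \<Rightarrow> (nat \<Rightarrow> complex poly mat) \<Rightarrow> bool" where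
  "orthogonal_polynomials N W Q \<longleftrightarrow>
     (\<forall>n. Q n \<in> carrier_mat N N \<and>
          (\<forall>k > n. mat_poly_coeff (Q n) k = 0\<^sub>m N N) \<and>
          invertible_mat (mat_poly_coeff (Q n) n)) \<and>
     (\<forall>n m. n \<noteq> m \<longrightarrow>
        mat_integral N (\<lambda>x. mat_poly_eval (Q n) x * W x * mat_adjoint (mat_poly_eval (Q m) x))
          = 0\<^sub>m N N)"

end

theory Submission
  imports Defs "Jordan_Normal_Form.Jordan_Normal_Form_Existence"
begin

text \<open>
  Orthogonality of \<open>Q\<^sub>n\<close> to the constants is a recursion that expresses every moment of a weight
  through its zeroth moment. Hence \<open>V - W M\<close> with \<open>M = W\<^sub>0\<^bsup>-1\<^esup> V\<^sub>0\<close> (\<open>W\<^sub>0\<close>, \<open>V\<^sub>0\<close> the zeroth moments) has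
  vanishing moments, so \<open>V = W M\<close> almost everywhere by compactness of the supports. As \<open>V\<close> and \<open>W\<close>
  are Hermitian, \<open>W M = M\<^sup>* W\<close>: the matrix \<open>M\<close> is selfadjoint for the inner product \<open>W\<^sub>0\<close>, hence
  diagonalizable with real eigenvalues, and its eigenspaces are orthogonal for \<open>W(x)\<close>, for almost
  every \<open>x\<close>. Two different eigenvalues would therefore make \<open>W\<close> reducible, so \<open>M\<close> is scalar.
\<close>

section \<open>Functions with vanishing moments\<close>

text \<open>Supplies the sigma-finiteness that uniqueness of densities requires. A countable cover
  by Borel sets of finite measure serves for the completed measure as well, since completion does
  not change the measure of Borel sets.\<close>

lemma sigma_finite_measure_lebesgue: "sigma_finite_measure (lebesgue :: real measure)"
proof
  obtain A :: "real set set" where A: "countable A" "A \<subseteq> sets lborel" "\<Union> A = space lborel"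
      "\<forall>a\<in>A. emeasure lborel a \<noteq> \<infinity>"
    using lborel.sigma_finite_countable by blast
  then show "\<exists>A. countable A \<and> A \<subseteq> sets (lebesgue :: real measure) \<and> \<Union> A = space lebesgue \<and>
      (\<forall>a\<in>A. emeasure lebesgue a \<noteq> \<infinity>)"
    by (intro exI[of _ A]) (auto simp: subset_iff)
qed

text \<open>Dynkin's argument: the sets over which \<open>f\<close> integrates to zero are closed
  under complements and countable disjoint unions, and they contain the rays, which are stable under
  intersection and generate the Borel sets. Uniqueness of densities, compared with the density 0,
  finishes.\<close>

lemma AE_zero_if_ray_integrals_zero:
  fixes f :: "real \<Rightarrow> 'a :: {banach, second_countable_topology}"
  assumes f: "integrable lebesgue f"
    and total: "(\<integral>x. f x \<partial>lebesgue) = 0"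
    and ray: "\<And>a. (LINT x:{a<..}|lebesgue. f x) = 0"
  shows "AE x in lebesgue. f x = 0"
proof -
  have si: "set_integrable lebesgue A f" if "A \<in> sets lebesgue" for A
    using f that by (simp add: set_integrable_def integrable_mult_indicator)
  have borel: "(LINT x:A|lebesgue. f x) = 0" if "A \<in> sets borel" for A
  proof -
    have "Int_stable (range (\<lambda>a::real. {a<..}))"
    proof (rule Int_stableI)
      fix A B :: "real set"
      assume "A \<in> range (\<lambda>a. {a<..})" "B \<in> range (\<lambda>a. {a<..})"
      then obtain a b where "A = {a<..}" "B = {b<..}" by blast
      then have "A \<inter> B = {max a b<..}" by auto
      then show "A \<inter> B \<in> range (\<lambda>a. {a<..})" by blast
    qed
    moreover have "range (\<lambda>a::real. {a<..}) \<subseteq> Pow UNIV"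
      by simp
    moreover have "A \<in> sigma_sets UNIV (range (\<lambda>a::real. {a<..}))"
      using that by (subst (asm) borel_Ioi) auto
    ultimately show ?thesis
    proof (induction rule: sigma_sets_induct_disjoint)
      case (basic A)
      then show ?case using ray by auto
    next
      case empty
      then show ?case by (simp add: set_lebesgue_integral_def)
    next
      case (compl A)
      then have A: "A \<in> sets borel"
        by (subst borel_Ioi) auto
      \<comment> \<open>The complement case rests on \<open>total\<close>: the integrals over
        \<open>A\<close> and its complement add up to the integral over the whole line.\<close>
      have "(LINT x:UNIV - A|lebesgue. f x) + (LINT x:A|lebesgue. f x)
          = (LINT x:(UNIV - A) \<union> A|lebesgue. f x)"
        using A by (intro set_integral_Un[symmetric] si) auto
      also have "\<dots> = 0"
        using total by (simp add: set_lebesgue_integral_def)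
      finally show ?case using compl by simp
    next
      case (union A)
      have A: "A i \<in> sets borel" for i
        using union(2) by (subst borel_Ioi) auto
      have "(LINT x:(\<Union>i. A i)|lebesgue. f x) = (\<Sum>i. LINT x:A i|lebesgue. f x)"
        using A union(1) by (intro lebesgue_integral_countable_add si)
          (auto simp: disjoint_family_on_def)
      also have "\<dots> = 0" using union(3) by simp
      finally show ?case .
    qed
  qed
  show ?thesis
  proof (rule sigma_finite_measure.density_unique_banach[OF sigma_finite_measure_lebesgue f, of "\<lambda>_. 0"])
    fix A assume A: "A \<in> sets (lebesgue :: real measure)"
    \<comment> \<open>A Lebesgue set is a Borel set \<open>S\<close> up to a subset \<open>P\<close>
      of a Borel null set \<open>P'\<close>, so the Borel case carries over.\<close>
    then obtain S P P' where S: "A = S \<union> P" "P \<subseteq> P'" "P' \<in> null_sets lborel" "S \<in> sets lborel"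
      by (rule sets_completionE)
    have "AE x in lebesgue. x \<notin> P'"
      using S(3) by (intro AE_completion AE_not_in)
    then have "AE x in lebesgue. indicat_real A x *\<^sub>R f x = indicat_real S x *\<^sub>R f x"
      by eventually_elim (use S in \<open>auto simp: indicator_def\<close>)
    moreover have "(\<lambda>x. indicat_real B x *\<^sub>R f x) \<in> borel_measurable lebesgue"
      if "B \<in> sets lebesgue" for B
      using si[OF that] by (simp add: set_integrable_def)
    ultimately have "(LINT x:A|lebesgue. f x) = (LINT x:S|lebesgue. f x)"
      unfolding set_lebesgue_integral_def using A S(4)
      by (intro integral_cong_AE) auto
    with borel[of S] S(4) show "(LINT x:A|lebesgue. f x) = (LINT x:A|lebesgue. 0)"
      by simp
  qed auto
qed

text \<open>By Weierstrass, \<open>g\<close> is uniformly close to a polynomial \<open>h\<close> on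
  \<open>S\<close>. The integral of \<open>h f\<close> is a combination of moments, hence zero, so
  the integral of \<open>g f\<close> is at most \<open>e\<close> times the L1 norm \<open>I\<close>
  of \<open>f\<close>, for every \<open>e > 0\<close>.\<close>

lemma integral_continuous_mult_eq_zero:
  fixes f :: "real \<Rightarrow> complex" and g :: "real \<Rightarrow> real"
  assumes int: "\<And>n::nat. integrable lebesgue (\<lambda>x. x ^ n *\<^sub>R f x)"
    and moment: "\<And>n::nat. (\<integral>x. x ^ n *\<^sub>R f x \<partial>lebesgue) = 0"
    and supp: "\<And>x. x \<notin> S \<Longrightarrow> f x = 0" and S: "compact S"
    and g: "continuous_on UNIV g"
    and gf: "integrable lebesgue (\<lambda>x. g x *\<^sub>R f x)"
  shows "(\<integral>x. g x *\<^sub>R f x \<partial>lebesgue) = 0"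
proof -
  have f: "integrable lebesgue f" using int[of 0] by simp
  define I where "I = (\<integral>x. norm (f x) \<partial>lebesgue)"
  have I: "I \<ge> 0" by (simp add: I_def)
  have bound: "norm (\<integral>x. g x *\<^sub>R f x \<partial>lebesgue) \<le> e * I" if e: "e > 0" for e
  proof -
    have "continuous_on S g" using g continuous_on_subset by blast
    then obtain h where h: "real_polynomial_function h" and close: "\<And>x. x \<in> S \<Longrightarrow> \<bar>g x - h x\<bar> < e"
      using Stone_Weierstrass_real_polynomial_function[OF S _ e] by metis
    from h obtain c n where hc: "h = (\<lambda>x. \<Sum>i\<le>n. c i * x ^ i)"
      unfolding real_polynomial_function_iff_sum by blast
    have hf: "h x *\<^sub>R f x = (\<Sum>i\<le>n. c i *\<^sub>R (x ^ i *\<^sub>R f x))" for x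
      by (simp add: hc scaleR_sum_left)
    have h_int: "integrable lebesgue (\<lambda>x. h x *\<^sub>R f x)"
      unfolding hf using int by (intro Bochner_Integration.integrable_sum integrable_scaleR_right) auto
    have "(\<integral>x. h x *\<^sub>R f x \<partial>lebesgue) = 0"
      unfolding hf using int moment
      by (subst Bochner_Integration.integral_sum)
        (auto simp del: scaleR_scaleR intro!: integrable_scaleR_right)
    then have "(\<integral>x. g x *\<^sub>R f x \<partial>lebesgue) = (\<integral>x. g x *\<^sub>R f x - h x *\<^sub>R f x \<partial>lebesgue)"
      using gf h_int by simp
    also have "norm \<dots> \<le> (\<integral>x. norm (g x *\<^sub>R f x - h x *\<^sub>R f x) \<partial>lebesgue)"
      by (rule integral_norm_bound)
    also have "\<dots> \<le> (\<integral>x. e * norm (f x) \<partial>lebesgue)"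
    proof (rule integral_mono)
      fix x
      \<comment> \<open>Closeness is known only on \<open>S\<close>; outside \<open>S\<close> both
        sides vanish because \<open>f x = 0\<close>.\<close>
      have "\<bar>g x - h x\<bar> * norm (f x) \<le> e * norm (f x)"
        using close[of x] supp[of x] by (cases "x \<in> S") (auto intro: mult_right_mono)
      then show "norm (g x *\<^sub>R f x - h x *\<^sub>R f x) \<le> e * norm (f x)"
        by (simp flip: scaleR_left_diff_distrib)
    qed (use gf h_int f in auto)
    also have "\<dots> = e * I" by (simp add: I_def)
    finally show ?thesis .
  qed
  have "norm (\<integral>x. g x *\<^sub>R f x \<partial>lebesgue) \<le> 0"
  proof (rule field_le_epsilon)
    fix e :: real assume "e > 0"
    \<comment> \<open>The bound is applied with \<open>e / (I + 1)\<close>; adding 1 avoids a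
      division by zero when \<open>I = 0\<close>.\<close>
    then have "norm (\<integral>x. g x *\<^sub>R f x \<partial>lebesgue) \<le> e / (I + 1) * I"
      using I by (intro bound) simp
    also have "\<dots> \<le> e"
      using I \<open>e > 0\<close> by (simp add: field_simps)
    finally show "norm (\<integral>x. g x *\<^sub>R f x \<partial>lebesgue) \<le> 0 + e"
      by simp
  qed
  then show ?thesis by simp
qed

text \<open>The indicator of a ray is a pointwise limit of continuous functions with values in
  [0, 1]. Dominated convergence, with \<open>norm (f x)\<close> as majorant, passes the vanishing of
  integrals from continuous factors to rays.\<close>

lemma AE_zero_if_moments_zero:
  fixes f :: "real \<Rightarrow> complex"
  assumes int: "\<And>n::nat. integrable lebesgue (\<lambda>x. x ^ n *\<^sub>R f x)"
    and moment: "\<And>n::nat. (\<integral>x. x ^ n *\<^sub>R f x \<partial>lebesgue) = 0"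
    and supp: "\<And>x. x \<notin> S \<Longrightarrow> f x = 0" and S: "compact S"
  shows "AE x in lebesgue. f x = 0"
proof (rule AE_zero_if_ray_integrals_zero)
  show f: "integrable lebesgue f" using int[of 0] by simp
  show "(\<integral>x. f x \<partial>lebesgue) = 0" using moment[of 0] by simp
  fix a :: real
  \<comment> \<open>For \<open>n > 0\<close> this is a ramp, 0 up to \<open>a\<close> and 1 from
    \<open>a + 1/n\<close> on. It is 0 at \<open>a\<close> itself, so the limit is the indicator of
    the open ray.\<close>
  define g :: "nat \<Rightarrow> real \<Rightarrow> real" where "g n x = min 1 (max 0 (real n * (x - a)))" for n x
  have g_cont: "continuous_on UNIV (g n)" for n
    unfolding g_def by (intro continuous_intros)
  have [measurable]: "g n \<in> borel_measurable lebesgue" for n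
    using g_cont[of n] by (intro measurable_completion) (simp add: borel_measurable_continuous_onI)
  have [measurable]: "f \<in> borel_measurable lebesgue" using f by simp
  have g_bound: "norm (g n x *\<^sub>R f x) \<le> norm (f x)" for n x
  proof -
    have "\<bar>g n x\<bar> \<le> 1" by (auto simp: g_def)
    then show ?thesis by (simp add: mult_left_le_one_le)
  qed
  have gf: "integrable lebesgue (\<lambda>x. g n x *\<^sub>R f x)" for n
    by (rule Bochner_Integration.integrable_bound[OF f])
      (use g_bound in \<open>auto simp del: norm_scaleR\<close>)
  have lim: "(\<lambda>n. g n x) \<longlonglongrightarrow> indicat_real {a<..} x" for x
  proof (cases "x > a")
    case True
    obtain m :: nat where m: "1 < real m * (x - a)"
      using True by (metis diff_gt_0_iff_gt reals_Archimedean3)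
    have "g n x = 1" if "n \<ge> m" for n
    proof -
      have "real m * (x - a) \<le> real n * (x - a)"
        using that True by (intro mult_right_mono) auto
      then show ?thesis using m by (simp add: g_def)
    qed
    then have "eventually (\<lambda>n. g n x = 1) sequentially"
      by (auto simp: eventually_sequentially)
    then show ?thesis using True by (simp add: tendsto_eventually)
  next
    case False
    then have "g n x = 0" for n
      by (simp add: g_def mult_nonneg_nonpos)
    then show ?thesis using False by simp
  qed
  have "(\<lambda>n. \<integral>x. g n x *\<^sub>R f x \<partial>lebesgue) \<longlonglongrightarrow> (LINT x:{a<..}|lebesgue. f x)"
    unfolding set_lebesgue_integral_def
  proof (rule integral_dominated_convergence[where w = "\<lambda>x. norm (f x)"])
    show "(\<lambda>x. indicat_real {a<..} x *\<^sub>R f x) \<in> borel_measurable lebesgue"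
      using integrable_mult_indicator[OF _ f, of "{a<..}"] by simp
    show "AE x in lebesgue. (\<lambda>n. g n x *\<^sub>R f x) \<longlonglongrightarrow> indicat_real {a<..} x *\<^sub>R f x"
      by (intro AE_I2 tendsto_scaleR lim tendsto_const)
    show "AE x in lebesgue. norm (g n x *\<^sub>R f x) \<le> norm (f x)" for n
      by (intro AE_I2 g_bound)
  qed (use f in auto)
  moreover have "(\<integral>x. g n x *\<^sub>R f x \<partial>lebesgue) = 0" for n
    by (rule integral_continuous_mult_eq_zero[OF int moment supp S g_cont gf])
  ultimately show "(LINT x:{a<..}|lebesgue. f x) = 0"
    by (simp add: LIMSEQ_const_iff)
qed

section \<open>Selfadjoint matrices with respect to a positive definite form\<close>

lemma mat_adjoint_carrier [simp]:
  "A \<in> carrier_mat n m \<Longrightarrow> mat_adjoint A \<in> carrier_mat m n"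
  by (auto simp: mat_adjoint_def)

lemma mat_adjoint_index [simp]:
  fixes A :: "complex mat"
  shows "i < dim_col A \<Longrightarrow> j < dim_row A \<Longrightarrow> mat_adjoint A $$ (i, j) = cnj (A $$ (j, i))"
    "dim_row (mat_adjoint A) = dim_col A" "dim_col (mat_adjoint A) = dim_row A"
  by (auto simp: mat_adjoint_def mat_of_rows_def)

lemma mat_adjoint_adjoint [simp]: "mat_adjoint (mat_adjoint A) = (A :: complex mat)"
  by (rule eq_matI) auto

lemma mat_adjoint_mult:
  fixes A B :: "complex mat"
  assumes "A \<in> carrier_mat n m" "B \<in> carrier_mat m k"
  shows "mat_adjoint (A * B) = mat_adjoint B * mat_adjoint A"
  using assms by (intro eq_matI) (auto simp: scalar_prod_def mult.commute)

lemma mult_mat3_index: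
  fixes A B C :: "'a :: comm_semiring_0 mat"
  assumes "A \<in> carrier_mat n m" "B \<in> carrier_mat m k" "C \<in> carrier_mat k l" "i < n" "j < l"
  shows "(A * B * C) $$ (i, j) = (\<Sum>q<k. \<Sum>p<m. A $$ (i, p) * B $$ (p, q) * C $$ (q, j))"
  using assms by (simp add: scalar_prod_def atLeast0LessThan sum_distrib_right del: assoc_mult_mat)

lemma cscalar_prod_adjoint:
  fixes A :: "complex mat"
  assumes A: "A \<in> carrier_mat n m" and v: "v \<in> carrier_vec m" and w: "w \<in> carrier_vec n"
  shows "(A *\<^sub>v v) \<bullet>c w = v \<bullet>c (mat_adjoint A *\<^sub>v w)"
proof -
  have "(A *\<^sub>v v) \<bullet>c w = (\<Sum>i<n. \<Sum>j<m. A $$ (i, j) * v $ j * cnj (w $ i))"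
    using assms by (simp add: scalar_prod_def atLeast0LessThan sum_distrib_right)
  also have "\<dots> = (\<Sum>j<m. \<Sum>i<n. A $$ (i, j) * v $ j * cnj (w $ i))"
    by (rule sum.swap)
  also have "\<dots> = v \<bullet>c (mat_adjoint A *\<^sub>v w)"
    using assms by (simp add: scalar_prod_def atLeast0LessThan sum_distrib_left mult_ac)
  finally show ?thesis .
qed

lemma cscalar_prod_congruence:
  fixes A T :: "complex mat"
  assumes A: "A \<in> carrier_mat n n" and T: "T \<in> carrier_mat n k" and v: "v \<in> carrier_vec k"
  shows "((mat_adjoint T * A * T) *\<^sub>v v) \<bullet>c v = (A *\<^sub>v (T *\<^sub>v v)) \<bullet>c (T *\<^sub>v v)"
proof -
  have "mat_adjoint T * A \<in> carrier_mat k n" using A T by (simp add: mult_carrier_mat[of _ k n])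
  then have "(mat_adjoint T * A * T) *\<^sub>v v = mat_adjoint T *\<^sub>v (A *\<^sub>v (T *\<^sub>v v))"
    using assms by (simp add: assoc_mult_mat_vec[of _ k n] assoc_mult_mat_vec[of _ k n _ n]
        del: assoc_mult_mat)
  then show ?thesis
    using assms cscalar_prod_adjoint[of "mat_adjoint T" k n "A *\<^sub>v (T *\<^sub>v v)" v] by simp
qed

lemma adjoint_congruence:
  fixes A T :: "complex mat"
  assumes "A \<in> carrier_mat n n" "T \<in> carrier_mat n k" "mat_adjoint A = A"
  shows "mat_adjoint (mat_adjoint T * A * T) = mat_adjoint T * A * T"
proof -
  have T': "mat_adjoint T \<in> carrier_mat k n" using assms by simp
  have "mat_adjoint (mat_adjoint T * A * T) = mat_adjoint T * (mat_adjoint A * T)"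
    using assms mat_adjoint_mult[of "mat_adjoint T * A" k n T k] mat_adjoint_mult[OF T' assms(1)]
      mult_carrier_mat[OF T' assms(1)]
    by (simp del: assoc_mult_mat)
  then show ?thesis using assms assoc_mult_mat[OF T' assms(1,2)] by simp
qed

section \<open>Definiteness under congruence, and diagonal entries and inverses of positive definite
  matrices\<close>

lemma pos_semidefinite_congruence:
  assumes "pos_semidefinite n A" "T \<in> carrier_mat n k"
  shows "pos_semidefinite k (mat_adjoint T * A * T)"
  using assms by (auto simp: pos_semidefinite_def cscalar_prod_congruence adjoint_congruence)

text \<open>The left inverse \<open>L\<close> expresses that \<open>T\<close> is injective, so the
  form is evaluated at \<open>T v\<close>, a nonzero vector. \<open>T\<close> may be rectangular,
  which allows restriction of the form to a subspace.\<close>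

lemma pos_definite_congruence:
  assumes A: "pos_definite n A" and T: "T \<in> carrier_mat n k"
    and L: "L \<in> carrier_mat k n" "L * T = 1\<^sub>m k"
  shows "pos_definite k (mat_adjoint T * A * T)"
proof -
  have "T *\<^sub>v v \<noteq> 0\<^sub>v n" if v: "v \<in> carrier_vec k" "v \<noteq> 0\<^sub>v k" for v
  proof
    assume "T *\<^sub>v v = 0\<^sub>v n"
    then have "(L * T) *\<^sub>v v = 0\<^sub>v k"
      using L(1) T v(1) by (simp add: assoc_mult_mat_vec[of _ k n]) (auto intro!: eq_vecI)
    then show False using L(2) v by simp
  qed
  then show ?thesis
    using A T by (auto simp: pos_definite_def cscalar_prod_congruence adjoint_congruence)
qed

lemma pos_definite_diag:
  assumes "pos_definite n A" "i < n"
  shows "0 < A $$ (i, i)"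
proof -
  have A: "A \<in> carrier_mat n n" using assms by (simp add: pos_definite_def)
  have "(A *\<^sub>v unit_vec n i) \<bullet>c unit_vec n i = A $$ (i, i)"
  proof -
    have "conjugate (unit_vec n i) = (unit_vec n i :: complex vec)"
      by (rule eq_vecI) (auto simp: unit_vec_def)
    then show ?thesis using A assms(2) by simp
  qed
  then show ?thesis
    using assms by (auto simp: pos_definite_def dest!: bspec[of _ _ "unit_vec n i"])
qed

lemma pos_definite_inverse:
  assumes "pos_definite n A"
  obtains B where "B \<in> carrier_mat n n" "A * B = 1\<^sub>m n" "B * A = 1\<^sub>m n"
proof -
  have A: "A \<in> carrier_mat n n" using assms by (simp add: pos_definite_def)
  have "det A \<noteq> 0"
  proof
    assume "det A = 0"
    then obtain v where v: "v \<in> carrier_vec n" "v \<noteq> 0\<^sub>v n" "A *\<^sub>v v = 0\<^sub>v n"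
      using det_0_iff_vec_prod_zero_field[OF A] by blast
    then have "0 < (A *\<^sub>v v) \<bullet>c v" using assms v(1,2) unfolding pos_definite_def by blast
    moreover have "0\<^sub>v n \<bullet>c v = 0" using v(1) by simp
    ultimately show False using v(3) by simp
  qed
  from det_non_zero_imp_unit[OF A this, of "()"] show ?thesis
    using that by (auto simp: Units_def ring_mat_simps)
qed

text \<open>The only feature of the Jordan form needed for the diagonalization. It survives
  prefixing a block: the entries joining the new block to the rest are zero, and within the rest
  both indices are shifted by the size \<open>n\<close> of the new block.\<close>

lemma jordan_matrix_bidiagonal:
  assumes "i < sum_list (map fst n_as)" "j < sum_list (map fst n_as)"
    and "jordan_matrix n_as $$ (i, j) \<noteq> (0 :: 'a :: {zero, one})"
  shows "i = j \<or> Suc i = j \<and> jordan_matrix n_as $$ (i, i) = jordan_matrix n_as $$ (j, j)"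
  using assms
proof (induction n_as arbitrary: i j)
  case Nil
  then show ?case by simp
next
  case (Cons na n_as)
  obtain n a where na: "na = (n, a)" by force
  show ?case
  proof (cases "i < n \<or> j < n")
    case True
    then show ?thesis
      using Cons.prems unfolding na jordan_matrix_Cons by (auto split: if_splits)
  next
    case False
    then have "i - n < sum_list (map fst n_as)" "j - n < sum_list (map fst n_as)"
      using Cons.prems(1,2) na by auto
    moreover from this have "jordan_matrix n_as $$ (i - n, j - n) \<noteq> 0"
      using Cons.prems(3) False unfolding na jordan_matrix_Cons by (simp split: if_splits)
    ultimately have "i - n = j - n \<or> Suc (i - n) = j - n \<and>
        jordan_matrix n_as $$ (i - n, i - n) = jordan_matrix n_as $$ (j - n, j - n)"
      by (rule Cons.IH)
    then show ?thesis
      using Cons.prems(1,2) False unfolding na jordan_matrix_Cons by (auto split: if_splits)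
  qed
qed

text \<open>
  If column \<open>i\<close> of \<open>J\<close> is diagonal, the entry \<open>(i, i + 1)\<close> of \<open>H J = J\<^sup>* H\<close> reads
  \<open>H\<^sub>i\<^sub>i J\<^sub>i\<^sub>,\<^sub>i\<^sub>+\<^sub>1 = 0\<close>, since \<open>J\<^sub>i\<^sub>i\<close> is real; take the least \<open>i\<close> with \<open>J\<^sub>i\<^sub>,\<^sub>i\<^sub>+\<^sub>1 \<noteq> 0\<close>.
\<close>
lemma selfadjoint_bidiagonal_is_real_diagonal:
  fixes H J :: "complex mat"
  assumes H: "pos_definite n H" and J: "J \<in> carrier_mat n n"
    and sa: "H * J = mat_adjoint J * H"
    and bi: "\<And>i j. i < n \<Longrightarrow> j < n \<Longrightarrow> J $$ (i, j) \<noteq> 0 \<Longrightarrow>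
      i = j \<or> Suc i = j \<and> J $$ (i, i) = J $$ (j, j)"
    and ij: "i < n" "j < n"
  shows "J $$ (i, j) = (if i = j then complex_of_real (Re (J $$ (i, i))) else 0)"
proof -
  have Hc: "H \<in> carrier_mat n n" using H by (simp add: pos_definite_def)
  have entry: "(\<Sum>k<n. H $$ (p, k) * J $$ (k, q)) = (\<Sum>k<n. cnj (J $$ (k, p)) * H $$ (k, q))"
    if "p < n" "q < n" for p q
  proof -
    have "(H * J) $$ (p, q) = (mat_adjoint J * H) $$ (p, q)" using sa by simp
    then show ?thesis using that Hc J by (simp add: scalar_prod_def atLeast0LessThan)
  qed
  \<comment> \<open>Both sums in \<open>entry\<close> at \<open>(p, p)\<close> reduce to one term,
    and the factor \<open>H $$ (p, p)\<close>, which is positive, cancels.\<close>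
  have real: "cnj (J $$ (p, p)) = J $$ (p, p)"
    if p: "p < n" and col: "\<And>k. k < n \<Longrightarrow> k \<noteq> p \<Longrightarrow> J $$ (k, p) = 0" for p
  proof -
    have "(\<Sum>k<n. H $$ (p, k) * J $$ (k, p)) = H $$ (p, p) * J $$ (p, p)"
      using p col by (subst sum.remove[of _ p]) (auto intro!: sum.neutral)
    moreover have "(\<Sum>k<n. cnj (J $$ (k, p)) * H $$ (k, p)) = cnj (J $$ (p, p)) * H $$ (p, p)"
      using p col by (subst sum.remove[of _ p]) (auto intro!: sum.neutral)
    ultimately show ?thesis
      using entry[OF p p] pos_definite_diag[OF H p] by auto
  qed
  have superdiag: "Suc p < n \<Longrightarrow> J $$ (p, Suc p) = 0" for p
  proof (induction p rule: less_induct)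
    case (less p)
    let ?q = "Suc p"
    have p: "p < n" using less.prems by simp
    show ?case
    proof (rule ccontr)
      assume nz: "J $$ (p, ?q) \<noteq> 0"
      then have eig: "J $$ (p, p) = J $$ (?q, ?q)" using bi[OF p less.prems] by simp
      \<comment> \<open>By \<open>bi\<close>, the only off-diagonal entry of column \<open>p\<close>
        that could be nonzero lies in the row just above the diagonal, where \<open>less.IH\<close>
        excludes it.\<close>
      have colp: "J $$ (k, p) = 0" if "k < n" "k \<noteq> p" for k
        using bi[OF that(1) p] that(2) less.IH[of k] less.prems by (cases "J $$ (k, p) = 0") auto
      have colq: "J $$ (k, ?q) = 0" if "k < n" "k \<noteq> p" "k \<noteq> ?q" for k
        using bi[OF that(1) less.prems] that(2,3) by auto
      have "(\<Sum>k<n. H $$ (p, k) * J $$ (k, ?q))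
          = H $$ (p, p) * J $$ (p, ?q) + H $$ (p, ?q) * J $$ (?q, ?q)"
        using p less.prems colq
        by (subst sum.remove[of _ p], simp_all, subst sum.remove[of _ ?q])
          (auto intro!: sum.neutral)
      moreover have "(\<Sum>k<n. cnj (J $$ (k, p)) * H $$ (k, ?q)) = cnj (J $$ (p, p)) * H $$ (p, ?q)"
        using p colp by (subst sum.remove[of _ p]) (auto intro!: sum.neutral)
      ultimately have "H $$ (p, p) * J $$ (p, ?q) = 0"
        using entry[OF p less.prems] real[OF p colp] eig by simp
      then show False using nz pos_definite_diag[OF H p] by auto
    qed
  qed
  have off: "J $$ (p, q) = 0" if "p < n" "q < n" "p \<noteq> q" for p q
    using bi[OF that(1,2)] superdiag[of p] that by auto
  show ?thesis
    using off[OF ij] real[OF ij(1) off] ij(1)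
    by (auto simp: complex_eq_iff)
qed

text \<open>Let \<open>S\<close> be a Jordan basis of \<open>M\<close> and \<open>J\<close> its
  Jordan form. The form \<open>H\<close> becomes \<open>K = mat_adjoint S * H * S\<close>, again
  positive definite, and selfadjointness becomes \<open>K * J = mat_adjoint J * K\<close>. This
  forces the bidiagonal matrix \<open>J\<close> to be diagonal and real.\<close>

lemma selfadjoint_diagonalizable:
  fixes H M :: "complex mat"
  assumes H: "pos_definite n H" and M: "M \<in> carrier_mat n n"
    and sa: "H * M = mat_adjoint M * H"
  obtains S S' and d :: "nat \<Rightarrow> real" where "S \<in> carrier_mat n n" "S' \<in> carrier_mat n n"
    "S * S' = 1\<^sub>m n" "S' * S = 1\<^sub>m n"
    "M * S = S * mat n n (\<lambda>(i, j). if i = j then complex_of_real (d i) else 0)"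
proof -
  have Hc: "H \<in> carrier_mat n n" using H by (simp add: pos_definite_def)
  obtain as where "char_poly M = (\<Prod>a\<leftarrow>as. [:- a, 1:])"
    using char_poly_factorized[OF M] by blast
  from jordan_nf_exists[OF M this] obtain n_as where "similar_mat M (jordan_matrix n_as)"
    by (auto simp: jordan_nf_def)
  then obtain S S' where wit: "similar_mat_wit M (jordan_matrix n_as) S S'"
    by (auto simp: similar_mat_def)
  define J where "J = jordan_matrix n_as"
  from similar_mat_witD2[OF M wit] have S: "S \<in> carrier_mat n n" "S' \<in> carrier_mat n n"
    "S * S' = 1\<^sub>m n" "S' * S = 1\<^sub>m n" "M = S * J * S'" and J: "J \<in> carrier_mat n n"
    by (auto simp: J_def)
  have size: "sum_list (map fst n_as) = n"
    using J by (metis J_def carrier_matD(1) jordan_matrix_dim(1))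
  have MS: "M * S = S * J"
    using S J by (simp add: assoc_mult_mat[of _ n n _ n _ n])
  have SM: "mat_adjoint S * mat_adjoint M = mat_adjoint J * mat_adjoint S"
    using MS S J M mat_adjoint_mult[of M n n S n] mat_adjoint_mult[of S n n J n] by simp
  define K where "K = mat_adjoint S * H * S"
  have K: "pos_definite n K"
    unfolding K_def using H S by (intro pos_definite_congruence) auto
  have adj: "mat_adjoint S \<in> carrier_mat n n" "mat_adjoint M \<in> carrier_mat n n" "mat_adjoint J \<in> carrier_mat n n"
    using S M J by auto
  note assoc = assoc_mult_mat[of _ n n _ n _ n]
  have "K * J = mat_adjoint S * H * (S * J)"
    unfolding K_def using S J Hc adj by (simp add: assoc)
  also have "\<dots> = mat_adjoint S * (H * M) * S"
    unfolding MS[symmetric] using S M Hc adj by (simp add: assoc)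
  also have "\<dots> = (mat_adjoint S * mat_adjoint M) * H * S"
    unfolding sa using S M Hc adj by (simp add: assoc)
  also have "\<dots> = mat_adjoint J * K"
    unfolding SM K_def
    using S J Hc adj assoc[of "mat_adjoint J" "mat_adjoint S * H" S] mult_carrier_mat[OF adj(1) Hc]
    by (simp add: assoc)
  finally have KJ: "K * J = mat_adjoint J * K" .
  have "J = mat n n (\<lambda>(i, j). if i = j then complex_of_real (Re (J $$ (i, i))) else 0)"
  proof (rule eq_matI)
    fix i j assume "i < dim_row (mat n n (\<lambda>(i, j). if i = j then complex_of_real (Re (J $$ (i, i))) else 0))"
      "j < dim_col (mat n n (\<lambda>(i, j). if i = j then complex_of_real (Re (J $$ (i, i))) else 0))"
    then have ij: "i < n" "j < n" by auto
    have "J $$ (i, j) = (if i = j then complex_of_real (Re (J $$ (i, i))) else 0)"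
      by (rule selfadjoint_bidiagonal_is_real_diagonal[OF K J KJ _ ij])
        (use jordan_matrix_bidiagonal[of _ n_as] in \<open>auto simp: J_def size\<close>)
    with ij show "J $$ (i, j) = mat n n (\<lambda>(i, j). if i = j then complex_of_real (Re (J $$ (i, i))) else 0) $$ (i, j)"
      by simp
  qed (use J in auto)
  with MS show ?thesis using that[OF S(1-4), of "\<lambda>i. Re (J $$ (i, i))"] by simp
qed

section \<open>Matrix weights and their moments\<close>

lemma matrix_weight_carrier: "matrix_weight a b N W \<Longrightarrow> W x \<in> carrier_mat N N"
  by (cases "x \<in> einterval a b") (auto simp: matrix_weight_def pos_semidefinite_def)

lemma matrix_weight_adjoint: "matrix_weight a b N W \<Longrightarrow> mat_adjoint (W x) = W x"
  by (cases "x \<in> einterval a b")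
    (auto simp: matrix_weight_def pos_semidefinite_def intro!: eq_matI)

lemma matrix_weight_moments:
  "matrix_weight a b N W \<Longrightarrow> mat_integrable N (\<lambda>x. complex_of_real (x ^ n) \<cdot>\<^sub>m W x)"
  by (simp add: matrix_weight_def)

lemma matrix_weight_integrable: "matrix_weight a b N W \<Longrightarrow> mat_integrable N W"
  using matrix_weight_moments[of a b N W 0] carrier_matD[OF matrix_weight_carrier[of a b N W]]
  by (simp add: mat_integrable_def)

lemma mat_integrable_mult_right:
  assumes "mat_integrable N F" "\<And>x. F x \<in> carrier_mat N N" "B \<in> carrier_mat N N"
  shows "mat_integrable N (\<lambda>x. F x * B)"
proof -
  have "(\<lambda>x. (F x * B) $$ (i, j)) = (\<lambda>x. \<Sum>k<N. F x $$ (i, k) * B $$ (k, j))" if "i < N" "j < N" for i j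
    using assms(3) that carrier_matD[OF assms(2)]
    by (intro ext) (simp add: scalar_prod_def atLeast0LessThan)
  then show ?thesis using assms(1)
    by (auto simp: mat_integrable_def intro!: Bochner_Integration.integrable_sum integrable_mult_left)
qed

lemma mat_integral_mult_right:
  assumes "mat_integrable N F" "\<And>x. F x \<in> carrier_mat N N" "B \<in> carrier_mat N N"
  shows "mat_integral N (\<lambda>x. F x * B) = mat_integral N F * B"
proof (rule eq_matI)
  fix i j assume "i < dim_row (mat_integral N F * B)" "j < dim_col (mat_integral N F * B)"
  then have ij: "i < N" "j < N" using assms(3) by (auto simp: mat_integral_def)
  have "(F x * B) $$ (i, j) = (\<Sum>k<N. F x $$ (i, k) * B $$ (k, j))" for x
    using assms(2)[of x] assms(3) ij by (simp add: scalar_prod_def atLeast0LessThan)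
  then show "mat_integral N (\<lambda>x. F x * B) $$ (i, j) = (mat_integral N F * B) $$ (i, j)"
    using assms(1,3) ij
    by (simp add: mat_integral_def mat_integrable_def scalar_prod_def atLeast0LessThan)
qed (use assms(3) in \<open>auto simp: mat_integral_def\<close>)

lemma mat_integrable_diff:
  assumes "mat_integrable N F" "mat_integrable N G"
    and "\<And>x. F x \<in> carrier_mat N N" "\<And>x. G x \<in> carrier_mat N N"
  shows "mat_integrable N (\<lambda>x. F x - G x)"
proof -
  have "(\<lambda>x. (F x - G x) $$ (i, j)) = (\<lambda>x. F x $$ (i, j) - G x $$ (i, j))" if "i < N" "j < N" for i j
    using assms(3,4) that by (metis carrier_matD index_minus_mat(1))
  then show ?thesis using assms(1,2) by (simp add: mat_integrable_def)
qed

lemma mat_integral_diff: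
  assumes "mat_integrable N F" "mat_integrable N G"
    and "\<And>x. F x \<in> carrier_mat N N" "\<And>x. G x \<in> carrier_mat N N"
  shows "mat_integral N (\<lambda>x. F x - G x) = mat_integral N F - mat_integral N G"
proof -
  have "(\<lambda>x. (F x - G x) $$ (i, j)) = (\<lambda>x. F x $$ (i, j) - G x $$ (i, j))" if "i < N" "j < N" for i j
    using assms(3,4) that by (metis carrier_matD index_minus_mat(1))
  then show ?thesis using assms(1,2)
    by (intro eq_matI) (auto simp: mat_integral_def mat_integrable_def)
qed

lemma mat_integrable_congruence:
  assumes F: "mat_integrable N F" "\<And>x. F x \<in> carrier_mat N N"
    and T: "T \<in> carrier_mat N k"
  shows "mat_integrable k (\<lambda>x. mat_adjoint T * F x * T)"
proof -
  have "(\<lambda>x. (mat_adjoint T * F x * T) $$ (i, j))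
      = (\<lambda>x. \<Sum>q<N. \<Sum>p<N. mat_adjoint T $$ (i, p) * F x $$ (p, q) * T $$ (q, j))"
    if "i < k" "j < k" for i j
    using F(2) T that by (intro ext mult_mat3_index[of _ k N _ N _ k]) auto
  then show ?thesis using F(1)
    by (auto simp: mat_integrable_def
        intro!: Bochner_Integration.integrable_sum integrable_mult_left integrable_mult_right)
qed

text \<open>Restriction of a weight to the column space of \<open>T\<close>; this is how the
  summands of a reducible weight arise. The left inverse \<open>L\<close> preserves definiteness
  almost everywhere, and the scalar \<open>x ^ n\<close> commutes with the congruence, which
  preserves the moments.\<close>

lemma matrix_weight_congruence:
  assumes W: "matrix_weight a b N W" and T: "T \<in> carrier_mat N k"
    and L: "L \<in> carrier_mat k N" "L * T = 1\<^sub>m k" and k: "0 < k"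
  shows "matrix_weight a b k (\<lambda>x. mat_adjoint T * W x * T)"
  unfolding matrix_weight_def
proof (intro conjI allI impI)
  note Wc = matrix_weight_carrier[OF W]
  have T': "mat_adjoint T \<in> carrier_mat k N" using T by simp
  show "a < b" using W by (simp add: matrix_weight_def)
  show "0 < k" by (rule k)
  show "pos_semidefinite k (mat_adjoint T * W x * T)" if "x \<in> einterval a b" for x
    using W T that by (intro pos_semidefinite_congruence) (auto simp: matrix_weight_def)
  show "mat_adjoint T * W x * T = 0\<^sub>m k k" if "x \<notin> einterval a b" for x
    using W T' T that by (simp add: matrix_weight_def)
  have "AE x in lebesgue. x \<in> einterval a b \<longrightarrow> pos_definite N (W x)"
    using W by (simp add: matrix_weight_def)
  then show "AE x in lebesgue. x \<in> einterval a b \<longrightarrow> pos_definite k (mat_adjoint T * W x * T)"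
    by eventually_elim (use T L in \<open>auto intro: pos_definite_congruence\<close>)
  fix n :: nat
  have "complex_of_real (x ^ n) \<cdot>\<^sub>m (mat_adjoint T * W x * T)
      = mat_adjoint T * (complex_of_real (x ^ n) \<cdot>\<^sub>m W x) * T" for x
    using T T' Wc[of x] mult_carrier_mat[OF T' Wc[of x]]
    by (simp add: mult_smult_assoc_mat[of _ k N] mult_smult_distrib[of _ k N] del: assoc_mult_mat)
  then show "mat_integrable k (\<lambda>x. complex_of_real (x ^ n) \<cdot>\<^sub>m (mat_adjoint T * W x * T))"
    using mat_integrable_congruence[OF matrix_weight_moments[OF W] _ T] Wc by simp
qed

text \<open>The quadratic form of the zeroth moment at \<open>v\<close> is the integral of
  \<open>q\<close>, the quadratic form of \<open>W x\<close> at \<open>v\<close>, which is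
  nonnegative everywhere and positive almost everywhere on the interval.\<close>

lemma pos_definite_mat_integral:
  assumes W: "matrix_weight a b N W"
  shows "pos_definite N (mat_integral N W)"
proof -
  note Wc = matrix_weight_carrier[OF W]
  have int: "integrable lebesgue (\<lambda>x. W x $$ (i, j))" if "i < N" "j < N" for i j
    using matrix_weight_integrable[OF W] that by (simp add: mat_integrable_def)
  have "mat_adjoint (mat_integral N W) = mat_integral N W"
  proof (rule eq_matI)
    fix i j assume "i < dim_row (mat_integral N W)" "j < dim_col (mat_integral N W)"
    then have ij: "i < N" "j < N" by (auto simp: mat_integral_def)
    have "cnj (W x $$ (j, i)) = W x $$ (i, j)" for x
      using mat_adjoint_index(1)[of i "W x" j] Wc[of x] ij matrix_weight_adjoint[OF W, of x] by simp
    with ij show "mat_adjoint (mat_integral N W) $$ (i, j) = mat_integral N W $$ (i, j)"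
      using Bochner_Integration.integral_cnj[of lebesgue "\<lambda>x. W x $$ (j, i)"] by (simp add: mat_integral_def)
  qed (auto simp: mat_integral_def)
  moreover have "0 < (mat_integral N W *\<^sub>v v) \<bullet>c v" if v: "v \<in> carrier_vec N" "v \<noteq> 0\<^sub>v N" for v
  proof -
    define q where "q x = (W x *\<^sub>v v) \<bullet>c v" for x
    have q: "q x = (\<Sum>i<N. (\<Sum>j<N. W x $$ (i, j) * v $ j) * cnj (v $ i))" for x
      using v(1) Wc[of x] by (simp add: q_def scalar_prod_def atLeast0LessThan)
    have q_int: "integrable lebesgue q"
      unfolding q using int by (intro Bochner_Integration.integrable_sum integrable_mult_left) auto
    have form: "(mat_integral N W *\<^sub>v v) \<bullet>c v = (\<integral>x. q x \<partial>lebesgue)"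
    proof -
      have row: "integrable lebesgue (\<lambda>x. \<Sum>j<N. W x $$ (i, j) * v $ j)"
        "(\<integral>x. (\<Sum>j<N. W x $$ (i, j) * v $ j) \<partial>lebesgue)
          = (\<Sum>j<N. (\<integral>x. W x $$ (i, j) \<partial>lebesgue) * v $ j)" if "i < N" for i
        using int[OF that] by auto
      have "(\<integral>x. q x \<partial>lebesgue)
          = (\<Sum>i<N. (\<Sum>j<N. (\<integral>x. W x $$ (i, j) \<partial>lebesgue) * v $ j) * cnj (v $ i))"
        unfolding q using row by (subst Bochner_Integration.integral_sum) auto
      then show ?thesis
        using v(1) by (simp add: mat_integral_def scalar_prod_def atLeast0LessThan)
    qed
    have "0 \<le> q x" for x
    proof (cases "x \<in> einterval a b")
      case True
      then show ?thesis using W v(1) by (simp add: q_def matrix_weight_def pos_semidefinite_def)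
    next
      case False
      then have "W x = 0\<^sub>m N N" using W by (simp add: matrix_weight_def)
      then show ?thesis using q[of x] by simp
    qed
    then have nonneg: "0 \<le> Re (q x)" "Im (q x) = 0" for x
      by (auto simp: less_eq_complex_def)
    \<comment> \<open>A zero integral would make \<open>q\<close> vanish almost everywhere and hence
      the interval a null set; but it is open and, by \<open>a < b\<close>, nonempty.\<close>
    have "(\<integral>x. Re (q x) \<partial>lebesgue) \<noteq> 0"
    proof
      assume "(\<integral>x. Re (q x) \<partial>lebesgue) = 0"
      then have "AE x in lebesgue. Re (q x) = 0"
        using q_int nonneg by (subst (asm) integral_nonneg_eq_0_iff_AE) auto
      moreover have "AE x in lebesgue. x \<in> einterval a b \<longrightarrow> pos_definite N (W x)"
        using W by (simp add: matrix_weight_def)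
      ultimately have "AE x in lebesgue. x \<notin> einterval a b"
      proof eventually_elim
        case (elim x)
        show ?case
        proof
          assume "x \<in> einterval a b"
          then have "0 < q x" using elim(2) v by (simp add: q_def pos_definite_def)
          then show False using elim(1) by (simp add: less_complex_def)
        qed
      qed
      then have "einterval a b \<in> null_sets lebesgue"
        by (subst (asm) AE_iff_null_sets[symmetric]) auto
      then have "einterval a b = {}"
        using open_not_negligible[OF open_einterval] by (auto simp: negligible_iff_null_sets)
      moreover obtain y where "a < ereal y" "ereal y < b"
        using W ereal_dense2[of a b] by (auto simp: matrix_weight_def)
      ultimately show False by (auto simp: einterval_def)
    qed
    moreover have "(\<integral>x. Re (q x) \<partial>lebesgue) \<ge> 0"
      using nonneg by simp
    ultimately have "(\<integral>x. Re (q x) \<partial>lebesgue) > 0" by linarith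
    moreover have "(\<integral>x. Im (q x) \<partial>lebesgue) = 0" using nonneg(2) by simp
    ultimately have "0 < (\<integral>x. q x \<partial>lebesgue)"
      using q_int by (simp add: less_complex_def)
    then show ?thesis using form by simp
  qed
  ultimately show ?thesis by (simp add: pos_definite_def mat_integral_def)
qed

section \<open>Matrix polynomials, orthogonality to constants and the recursion for moments\<close>

lemma mat_poly_eval_index:
  assumes P: "P \<in> carrier_mat N N" and ij: "i < N" "j < N"
    and deg: "\<And>k. k > n \<Longrightarrow> mat_poly_coeff P k = 0\<^sub>m N N"
  shows "mat_poly_eval P x $$ (i, j) = (\<Sum>t\<le>n. mat_poly_coeff P t $$ (i, j) * complex_of_real (x ^ t))"
proof -
  let ?p = "P $$ (i, j)"
  have "coeff ?p t = 0" if "t > n" for t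
    using arg_cong[OF deg[OF that], of "\<lambda>B. B $$ (i, j)"] P ij
    by (simp add: mat_poly_coeff_def)
  then have "degree ?p \<le> n" by (simp add: degree_le)
  then have "poly ?p (complex_of_real x) = (\<Sum>t\<le>n. coeff ?p t * complex_of_real x ^ t)"
    \<comment> \<open>An entry may have degree below the common bound \<open>n\<close>; the
      additional coefficients are zero.\<close>
    unfolding poly_altdef by (intro sum.mono_neutral_left) (auto simp: coeff_eq_0)
  then show ?thesis using P ij by (simp add: mat_poly_eval_def mat_poly_coeff_def)
qed

lemma mat_poly_eval_mult_index:
  assumes P: "P \<in> carrier_mat N N" and A: "A \<in> carrier_mat N N" and ij: "i < N" "j < N"
    and deg: "\<And>k. k > n \<Longrightarrow> mat_poly_coeff P k = 0\<^sub>m N N"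
  shows "(mat_poly_eval P x * A) $$ (i, j)
    = (\<Sum>k<N. \<Sum>t\<le>n. mat_poly_coeff P t $$ (i, k) * (complex_of_real (x ^ t) * A $$ (k, j)))"
proof -
  have "mat_poly_eval P x \<in> carrier_mat N N" using P by (simp add: mat_poly_eval_def)
  then have "(mat_poly_eval P x * A) $$ (i, j) = (\<Sum>k<N. mat_poly_eval P x $$ (i, k) * A $$ (k, j))"
    using A ij by (simp add: scalar_prod_def atLeast0LessThan)
  also have "\<dots> = (\<Sum>k<N. \<Sum>t\<le>n. mat_poly_coeff P t $$ (i, k) * (complex_of_real (x ^ t) * A $$ (k, j)))"
    using mat_poly_eval_index[OF P ij(1) _ deg, where x = x]
    by (simp add: sum_distrib_right mult.assoc)
  finally show ?thesis .
qed

lemma mat_poly_eval_carrier [simp]: "P \<in> carrier_mat N N \<Longrightarrow> mat_poly_eval P x \<in> carrier_mat N N"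
  by (simp add: mat_poly_eval_def)

lemma orthogonal_polynomialsD:
  assumes "orthogonal_polynomials N W Q"
  shows "Q n \<in> carrier_mat N N" "k > n \<Longrightarrow> mat_poly_coeff (Q n) k = 0\<^sub>m N N"
    "invertible_mat (mat_poly_coeff (Q n) n)"
    "n \<noteq> m \<Longrightarrow> mat_integral N (\<lambda>x. mat_poly_eval (Q n) x * W x * mat_adjoint (mat_poly_eval (Q m) x)) = 0\<^sub>m N N"
  using assms by (auto simp: orthogonal_polynomials_def)

lemma mat_integrable_momentD:
  assumes "mat_integrable N (\<lambda>x. complex_of_real (x ^ n) \<cdot>\<^sub>m F x)" "\<And>x. F x \<in> carrier_mat N N"
    and "i < N" "j < N"
  shows "integrable lebesgue (\<lambda>x. complex_of_real (x ^ n) * F x $$ (i, j))"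
proof -
  have "integrable lebesgue (\<lambda>x. (complex_of_real (x ^ n) \<cdot>\<^sub>m F x) $$ (i, j))"
    using assms(1,3,4) unfolding mat_integrable_def by blast
  then show ?thesis
    using assms(3,4) carrier_matD[OF assms(2)] by simp
qed

lemma mat_integrable_poly_mult:
  assumes F: "\<And>n. mat_integrable N (\<lambda>x. complex_of_real (x ^ n) \<cdot>\<^sub>m F x)" "\<And>x. F x \<in> carrier_mat N N"
    and P: "P \<in> carrier_mat N N" and deg: "\<And>k. k > n \<Longrightarrow> mat_poly_coeff P k = 0\<^sub>m N N"
  shows "mat_integrable N (\<lambda>x. mat_poly_eval P x * F x)"
  using mat_integrable_momentD[OF F]
  by (auto simp: mat_integrable_def mat_poly_eval_mult_index[OF P F(2) _ _ deg])

text \<open>\<open>invertible_mat\<close> does not state the dimensions of the inverse; they are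
  read off from the column counts of the two products.\<close>

lemma invertible_matE:
  assumes "invertible_mat A" "A \<in> carrier_mat n n"
  obtains B where "B \<in> carrier_mat n n" "A * B = 1\<^sub>m n" "B * A = 1\<^sub>m n"
proof -
  obtain B where B: "A * B = 1\<^sub>m (dim_row A)" "B * A = 1\<^sub>m (dim_row B)"
    using assms(1) by (auto simp: invertible_mat_def inverts_mat_def)
  have "dim_col B = n" using arg_cong[OF B(1), of dim_col] assms(2) by simp
  moreover have "dim_row B = n" using arg_cong[OF B(2), of dim_col] assms(2) by simp
  ultimately show ?thesis using that[of B] B assms(2) by auto
qed

text \<open>\<open>Q 0\<close> is an invertible constant \<open>C\<close>. The orthogonality of
  \<open>Q n\<close> and \<open>Q 0\<close> therefore says that the integral in question times
  \<open>mat_adjoint C\<close> is zero, and the right factor can be cancelled.\<close>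

lemma orthogonal_to_constants:
  assumes W: "matrix_weight a b N W" and Q: "orthogonal_polynomials N W Q" and n: "n \<noteq> 0"
  shows "mat_integral N (\<lambda>x. mat_poly_eval (Q n) x * W x) = 0\<^sub>m N N"
proof -
  note Wc = matrix_weight_carrier[OF W]
  note Qc = orthogonal_polynomialsD(1)[OF Q]
  define C where "C = mat_poly_coeff (Q 0) 0"
  have C: "C \<in> carrier_mat N N" using Qc by (simp add: C_def mat_poly_coeff_def)
  obtain D where D: "D \<in> carrier_mat N N" "D * C = 1\<^sub>m N"
    using invertible_matE[OF orthogonal_polynomialsD(3)[OF Q, of 0]] C by (auto simp: C_def)
  have "mat_poly_eval (Q 0) x = C" for x
  proof (rule eq_matI)
    fix i j assume "i < dim_row C" "j < dim_col C"
    then show "mat_poly_eval (Q 0) x $$ (i, j) = C $$ (i, j)"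
      using C mat_poly_eval_index[OF Qc _ _ orthogonal_polynomialsD(2)[OF Q], of i j 0]
      by (simp add: C_def)
  qed (use C Qc[of 0] in \<open>auto simp: mat_poly_eval_def\<close>)
  then have "0\<^sub>m N N = mat_integral N (\<lambda>x. mat_poly_eval (Q n) x * W x * mat_adjoint C)"
    using orthogonal_polynomialsD(4)[OF Q n] by simp
  also have "\<dots> = mat_integral N (\<lambda>x. mat_poly_eval (Q n) x * W x) * mat_adjoint C"
    using Wc Qc C
    by (intro mat_integral_mult_right mat_integrable_poly_mult[OF matrix_weight_moments[OF W] Wc Qc
          orthogonal_polynomialsD(2)[OF Q]] mult_carrier_mat[of _ N N]) auto
  finally have zero: "mat_integral N (\<lambda>x. mat_poly_eval (Q n) x * W x) * mat_adjoint C = 0\<^sub>m N N" ..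
  have "mat_adjoint C * mat_adjoint D = 1\<^sub>m N"
  proof -
    have "mat_adjoint (D * C) = 1\<^sub>m N"
      unfolding D(2) by (rule eq_matI) auto
    then show ?thesis using D(1) C by (simp add: mat_adjoint_mult)
  qed
  moreover have "mat_integral N (\<lambda>x. mat_poly_eval (Q n) x * W x) \<in> carrier_mat N N"
    by (simp add: mat_integral_def)
  ultimately have "mat_integral N (\<lambda>x. mat_poly_eval (Q n) x * W x)
      = (mat_integral N (\<lambda>x. mat_poly_eval (Q n) x * W x) * mat_adjoint C) * mat_adjoint D"
    using C D(1) by (simp add: assoc_mult_mat[of _ N N _ N _ N])
  then show ?thesis using zero D(1) by simp
qed

text \<open>Strong induction on \<open>n\<close>: integrating \<open>Q n\<close> against
  \<open>F\<close> gives the leading coefficient times the \<open>n\<close>-th moment plus terms in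
  lower moments, which vanish by induction; the leading coefficient is invertible. \<open>F\<close>
  is general because the result is applied to a difference built from two weights.\<close>

lemma moments_zero:
  assumes F: "\<And>n. mat_integrable N (\<lambda>x. complex_of_real (x ^ n) \<cdot>\<^sub>m F x)" "\<And>x. F x \<in> carrier_mat N N"
    and Q: "orthogonal_polynomials N W Q"
    and zero: "mat_integral N F = 0\<^sub>m N N"
    and orth: "\<And>n. n \<noteq> 0 \<Longrightarrow> mat_integral N (\<lambda>x. mat_poly_eval (Q n) x * F x) = 0\<^sub>m N N"
    and ij: "i < N" "j < N"
  shows "(\<integral>x. complex_of_real (x ^ n) * F x $$ (i, j) \<partial>lebesgue) = 0"
  using ij(1)
proof (induction n arbitrary: i rule: less_induct)
  case (less n)
  \<comment> \<open>The column \<open>j\<close> stays fixed: \<open>vec N (m t)\<close> is column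
    \<open>j\<close> of the \<open>t\<close>-th moment. The row varies in the induction, as the
    matrix product mixes rows.\<close>
  define m where "m t k = (\<integral>x. complex_of_real (x ^ t) * F x $$ (k, j) \<partial>lebesgue)" for t k
  show ?case
  proof (cases "n = 0")
    case True
    then show ?thesis using arg_cong[OF zero, of "\<lambda>A. A $$ (i, j)"] less.prems ij(2)
      by (simp add: mat_integral_def)
  next
    case False
    define A where "A = mat_poly_coeff (Q n) n"
    have A: "A \<in> carrier_mat N N"
      using orthogonal_polynomialsD(1)[OF Q] by (simp add: A_def mat_poly_coeff_def)
    obtain B where B: "B \<in> carrier_mat N N" "B * A = 1\<^sub>m N"
      using invertible_matE[OF orthogonal_polynomialsD(3)[OF Q, of n]] A by (auto simp: A_def)
    have "A *\<^sub>v vec N (m n) = 0\<^sub>v N"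
    proof (rule eq_vecI)
      fix l assume "l < dim_vec (0\<^sub>v N :: complex vec)"
      then have l: "l < N" by simp
      have "0 = (\<integral>x. (mat_poly_eval (Q n) x * F x) $$ (l, j) \<partial>lebesgue)"
        using arg_cong[OF orth[OF False], of "\<lambda>A. A $$ (l, j)"] l ij(2)
        by (simp add: mat_integral_def)
      also have "\<dots> = (\<Sum>k<N. \<Sum>t\<le>n. mat_poly_coeff (Q n) t $$ (l, k) * m t k)"
      proof -
        have int: "integrable lebesgue (\<lambda>x. mat_poly_coeff (Q n) t $$ (l, k)
            * (complex_of_real (x ^ t) * F x $$ (k, j)))" if "k < N" for k t
          by (intro integrable_mult_right mat_integrable_momentD[OF F that ij(2)])
        have "(mat_poly_eval (Q n) x * F x) $$ (l, j)
          = (\<Sum>k<N. \<Sum>t\<le>n. mat_poly_coeff (Q n) t $$ (l, k) * (complex_of_real (x ^ t) * F x $$ (k, j)))" for x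
          using orthogonal_polynomialsD(1,2)[OF Q] F(2) l ij(2) by (intro mat_poly_eval_mult_index) auto
        then have "(\<integral>x. (mat_poly_eval (Q n) x * F x) $$ (l, j) \<partial>lebesgue)
          = (\<integral>x. (\<Sum>k<N. \<Sum>t\<le>n. mat_poly_coeff (Q n) t $$ (l, k) * (complex_of_real (x ^ t) * F x $$ (k, j))) \<partial>lebesgue)"
          by simp
        also have "\<dots> = (\<Sum>k<N. \<integral>x. (\<Sum>t\<le>n. mat_poly_coeff (Q n) t $$ (l, k)
            * (complex_of_real (x ^ t) * F x $$ (k, j))) \<partial>lebesgue)"
          by (intro Bochner_Integration.integral_sum Bochner_Integration.integrable_sum int) auto
        also have "\<dots> = (\<Sum>k<N. \<Sum>t\<le>n. \<integral>x. mat_poly_coeff (Q n) t $$ (l, k)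
            * (complex_of_real (x ^ t) * F x $$ (k, j)) \<partial>lebesgue)"
          by (intro sum.cong refl Bochner_Integration.integral_sum int) auto
        also have "\<dots> = (\<Sum>k<N. \<Sum>t\<le>n. mat_poly_coeff (Q n) t $$ (l, k) * m t k)"
          by (simp add: m_def del: of_real_power)
        finally show ?thesis .
      qed
      also have "\<dots> = (\<Sum>k<N. A $$ (l, k) * m n k)"
      proof (rule sum.cong)
        fix k assume "k \<in> {..<N}"
        \<comment> \<open>The induction hypothesis at every row \<open>k\<close> removes all moments
          below \<open>n\<close>, leaving only the leading term.\<close>
        then have "m t k = 0" if "t < n" for t
          using less.IH[OF that, of k] by (simp add: m_def)
        then show "(\<Sum>t\<le>n. mat_poly_coeff (Q n) t $$ (l, k) * m t k) = A $$ (l, k) * m n k"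
          unfolding A_def by (subst sum.remove[of _ n]) (auto intro!: sum.neutral)
      qed simp
      finally show "(A *\<^sub>v vec N (m n)) $ l = 0\<^sub>v N $ l"
        using l A by (simp add: scalar_prod_def atLeast0LessThan)
    qed (use A in simp)
    then have "(B * A) *\<^sub>v vec N (m n) = B *\<^sub>v 0\<^sub>v N"
      using A B(1) by (simp add: assoc_mult_mat_vec[of _ N N])
    then have "vec N (m n) = B *\<^sub>v 0\<^sub>v N" using B(2) by simp
    from arg_cong[OF this, of "\<lambda>v. v $ i"] show ?thesis
      using less.prems B(1) by (simp add: m_def)
  qed
qed

text \<open>Each entry is a scalar function with vanishing moments and compact support; the finitely
  many exceptional null sets are then combined.\<close>

lemma AE_zero_if_orthogonal:
  assumes F: "\<And>n. mat_integrable N (\<lambda>x. complex_of_real (x ^ n) \<cdot>\<^sub>m F x)" "\<And>x. F x \<in> carrier_mat N N"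
    and Q: "orthogonal_polynomials N W Q"
    and zero: "mat_integral N F = 0\<^sub>m N N"
    and orth: "\<And>n. n \<noteq> 0 \<Longrightarrow> mat_integral N (\<lambda>x. mat_poly_eval (Q n) x * F x) = 0\<^sub>m N N"
    and supp: "compact K" "\<And>x. x \<notin> K \<Longrightarrow> F x = 0\<^sub>m N N"
  shows "AE x in lebesgue. F x = 0\<^sub>m N N"
proof -
  have entry: "AE x in lebesgue. F x $$ (i, j) = 0" if ij: "i < N" "j < N" for i j
  proof (rule AE_zero_if_moments_zero[where S = K])
    show "integrable lebesgue (\<lambda>x. x ^ n *\<^sub>R F x $$ (i, j))" for n :: nat
      using mat_integrable_momentD[OF F ij, of n] by (simp only: scaleR_conv_of_real)
    show "(\<integral>x. x ^ n *\<^sub>R F x $$ (i, j) \<partial>lebesgue) = 0" for n :: nat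
      unfolding scaleR_conv_of_real by (rule moments_zero[OF F Q zero _ ij]) (rule orth)
  qed (use supp ij in auto)
  have "AE x in lebesgue. \<forall>i\<in>{..<N}. \<forall>j\<in>{..<N}. F x $$ (i, j) = 0"
    using entry by (intro AE_finite_allI) auto
  then show ?thesis
    by eventually_elim (use carrier_matD[OF F(2)] in \<open>auto intro!: eq_matI\<close>)
qed

text \<open>The choice of \<open>M\<close> makes the zeroth moment of \<open>U = V - W M\<close>
  vanish. Multiplication by a constant on the right respects orthogonality of \<open>Q n\<close> to
  constants, a condition with \<open>Q n\<close> on the left, so \<open>U\<close> inherits it from
  \<open>V\<close> and \<open>W\<close> and must vanish almost everywhere.\<close>

lemma weight_eq_mult_constant:
  assumes W: "matrix_weight a b N W" "compact_support N W" "orthogonal_polynomials N W Q"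
    and V: "matrix_weight c d N V" "compact_support N V" "orthogonal_polynomials N V Q"
    and M: "M \<in> carrier_mat N N" "mat_integral N V = mat_integral N W * M"
  shows "AE x in lebesgue. V x = W x * M"
proof -
  note Wc = matrix_weight_carrier[OF W(1)] and Vc = matrix_weight_carrier[OF V(1)]
  note Qc = orthogonal_polynomialsD(1)[OF W(3)]
  define U where "U x = V x - W x * M" for x
  have WM: "W x * M \<in> carrier_mat N N" for x
    using mult_carrier_mat[OF Wc M(1)] .
  have Uc: "U x \<in> carrier_mat N N" for x
    unfolding U_def by (rule minus_carrier_mat[OF WM])
  have U_scaled: "complex_of_real (x ^ n) \<cdot>\<^sub>m U x
      = complex_of_real (x ^ n) \<cdot>\<^sub>m V x - (complex_of_real (x ^ n) \<cdot>\<^sub>m W x) * M" for n x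
  proof -
    have "(complex_of_real (x ^ n) \<cdot>\<^sub>m W x) * M = complex_of_real (x ^ n) \<cdot>\<^sub>m (W x * M)"
      by (rule mult_smult_assoc_mat[OF Wc M(1)])
    then show ?thesis
      using carrier_matD[OF Vc[of x]] carrier_matD[OF WM[of x]]
      by (intro eq_matI) (auto simp: U_def right_diff_distrib)
  qed
  have U_mom: "mat_integrable N (\<lambda>x. complex_of_real (x ^ n) \<cdot>\<^sub>m U x)" for n
    unfolding U_scaled
    by (intro mat_integrable_diff mat_integrable_mult_right matrix_weight_moments[OF W(1)]
        matrix_weight_moments[OF V(1)] mult_carrier_mat[of _ N N] smult_carrier_mat Wc Vc M(1))
  have U0: "mat_integral N U = 0\<^sub>m N N"
  proof -
    have "mat_integral N U = mat_integral N V - mat_integral N (\<lambda>x. W x * M)"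
      unfolding U_def using matrix_weight_integrable[OF W(1)] matrix_weight_integrable[OF V(1)] M(1) Vc Wc WM
      by (intro mat_integral_diff mat_integrable_mult_right)
    also have "mat_integral N (\<lambda>x. W x * M) = mat_integral N V"
      using matrix_weight_integrable[OF W(1)] M Wc by (simp add: mat_integral_mult_right)
    finally show ?thesis by (simp add: mat_integral_def)
  qed
  have orth: "mat_integral N (\<lambda>x. mat_poly_eval (Q n) x * U x) = 0\<^sub>m N N" if n: "n \<noteq> 0" for n
  proof -
    define E where "E x = mat_poly_eval (Q n) x" for x
    have E: "E x \<in> carrier_mat N N" for x using Qc by (simp add: E_def)
    have EW: "E x * W x \<in> carrier_mat N N" and EV: "E x * V x \<in> carrier_mat N N" for x
      using mult_carrier_mat[OF E Wc] mult_carrier_mat[OF E Vc] by auto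
    have EWM: "E x * W x * M \<in> carrier_mat N N" for x
      using mult_carrier_mat[OF EW M(1)] .
    have int: "mat_integrable N (\<lambda>x. E x * W x)" "mat_integrable N (\<lambda>x. E x * V x)"
      unfolding E_def
      using mat_integrable_poly_mult[OF matrix_weight_moments[OF W(1)] Wc Qc orthogonal_polynomialsD(2)[OF W(3)]]
        mat_integrable_poly_mult[OF matrix_weight_moments[OF V(1)] Vc Qc orthogonal_polynomialsD(2)[OF W(3)]]
      by auto
    have "E x * U x = E x * V x - E x * W x * M" for x
      unfolding U_def mult_minus_distrib_mat[OF E Vc WM] assoc_mult_mat[OF E Wc M(1)] ..
    then have "mat_integral N (\<lambda>x. E x * U x)
        = mat_integral N (\<lambda>x. E x * V x) - mat_integral N (\<lambda>x. E x * W x * M)"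
      using int EV EWM EW M(1) by (simp add: mat_integral_diff mat_integrable_mult_right del: assoc_mult_mat)
    also have "\<dots> = mat_integral N (\<lambda>x. E x * V x) - mat_integral N (\<lambda>x. E x * W x) * M"
      using mat_integral_mult_right[OF int(1) EW M(1)] by simp
    also have "\<dots> = 0\<^sub>m N N"
      unfolding E_def orthogonal_to_constants[OF W(1,3) n] orthogonal_to_constants[OF V(1,3) n]
      using M(1) by (intro eq_matI) auto
    finally show ?thesis by (simp add: E_def)
  qed
  \<comment> \<open>The two weights may live on different intervals, so the support of
    \<open>U\<close> is enclosed in the union of both supports.\<close>
  let ?K = "closure {x. W x \<noteq> 0\<^sub>m N N} \<union> closure {x. V x \<noteq> 0\<^sub>m N N}"
  have K: "compact ?K"
    using W(2) V(2) by (auto simp: compact_support_def)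
  have supp: "U x = 0\<^sub>m N N" if "x \<notin> ?K" for x
  proof -
    have "W x = 0\<^sub>m N N" "V x = 0\<^sub>m N N"
      using that closure_subset[of "{x. W x \<noteq> 0\<^sub>m N N}"] closure_subset[of "{x. V x \<noteq> 0\<^sub>m N N}"]
      by blast+
    then show ?thesis using M(1) by (intro eq_matI) (auto simp: U_def)
  qed
  have "AE x in lebesgue. U x = 0\<^sub>m N N"
    by (rule AE_zero_if_orthogonal[OF U_mom Uc W(3) U0 orth K supp])
  then show ?thesis
  proof eventually_elim
    case (elim x)
    show ?case
    proof (rule eq_matI)
      fix i j assume "i < dim_row (W x * M)" "j < dim_col (W x * M)"
      then have ij: "i < N" "j < N" using WM[of x] by auto
      then have "U x $$ (i, j) = V x $$ (i, j) - (W x * M) $$ (i, j)"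
        using WM[of x] Vc[of x] unfolding U_def by (metis carrier_matD index_minus_mat(1))
      then show "V x $$ (i, j) = (W x * M) $$ (i, j)"
        using elim ij by simp
    qed (use Vc[of x] Wc[of x] M(1) in auto)
  qed
qed

section \<open>Reducibility\<close>

text \<open>The product has entries \<open>(S' * S) $$ (p l, p j)\<close>, and injectivity of
  \<open>p\<close> makes them those of the identity. It applies both to a proper choice of columns
  and to a permutation of all of them.\<close>

lemma column_selection_left_inverse:
  assumes S: "S \<in> carrier_mat n n" "S' \<in> carrier_mat n n" "S' * S = 1\<^sub>m n"
    and p: "inj_on p {..<k}" "p ` {..<k} \<subseteq> {..<n}"
  shows "mat k n (\<lambda>(l, i). S' $$ (p l, i)) * mat n k (\<lambda>(i, j). S $$ (i, p j)) = 1\<^sub>m k"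
proof (rule eq_matI)
  fix l j assume "l < dim_row (1\<^sub>m k)" "j < dim_col (1\<^sub>m k)"
  then have lj: "l < k" "j < k" by auto
  then have "p l < n" "p j < n" using p(2) by auto
  moreover from this have "(S' * S) $$ (p l, p j) = 1\<^sub>m n $$ (p l, p j)" using S(3) by simp
  ultimately have "(\<Sum>i<n. S' $$ (p l, i) * S $$ (i, p j)) = (if p l = p j then 1 else 0)"
    using S(1,2) by (simp add: scalar_prod_def atLeast0LessThan)
  also have "p l = p j \<longleftrightarrow> l = j" using p(1) lj by (auto simp: inj_on_def)
  finally show "(mat k n (\<lambda>(l, i). S' $$ (p l, i)) * mat n k (\<lambda>(i, j). S $$ (i, p j))) $$ (l, j)
      = 1\<^sub>m k $$ (l, j)"
    using lj by (simp add: scalar_prod_def atLeast0LessThan)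
qed auto

text \<open>Expresses the two blocks and the full permuted matrix through one matrix,
  \<open>mat_adjoint S * A * S\<close>, so that they can be compared entry by entry.\<close>

lemma column_selection_congruence:
  fixes S A :: "complex mat"
  assumes S: "S \<in> carrier_mat n n" and A: "A \<in> carrier_mat n n"
    and p: "p ` {..<k} \<subseteq> {..<n}" and ij: "i < k" "j < k"
  defines "T \<equiv> mat n k (\<lambda>(i, j). S $$ (i, p j))"
  shows "(mat_adjoint T * A * T) $$ (i, j) = (mat_adjoint S * A * S) $$ (p i, p j)"
proof -
  have T: "T \<in> carrier_mat n k" by (simp add: T_def)
  have pij: "p i < n" "p j < n" using p ij by auto
  show ?thesis
    unfolding mult_mat3_index[OF mat_adjoint_carrier[OF T] A T ij]
      mult_mat3_index[OF mat_adjoint_carrier[OF S] A S pij]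
    using S ij pij by (simp add: T_def)
qed

text \<open>Listing the indices satisfying \<open>P\<close> first turns the vanishing entries into two off-diagonal blocks.\<close>
lemma not_irreducible_if_entries_vanish:
  assumes W: "matrix_weight a b N W"
    and S: "S \<in> carrier_mat N N" "S' \<in> carrier_mat N N" "S' * S = 1\<^sub>m N"
    and P: "i0 < N" "P i0" "j0 < N" "\<not> P j0"
    and zero: "AE x in lebesgue. \<forall>i<N. \<forall>j<N. P i \<noteq> P j \<longrightarrow> (mat_adjoint S * W x * S) $$ (i, j) = 0"
  shows "\<not> irreducible_weight a b N W"
proof -
  note Wc = matrix_weight_carrier[OF W]
  define xs ys where "xs = filter P [0..<N]" and "ys = filter (\<lambda>i. \<not> P i) [0..<N]"
  define k m where "k = length xs" and "m = length ys"
  define p where "p j = (xs @ ys) ! j" for j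
  have km: "k + m = N"
    using sum_length_filter_compl[of P "[0..<N]"] by (simp add: k_def m_def xs_def ys_def)
  \<comment> \<open>The witnesses make both blocks nonempty, so that each has positive size smaller
    than \<open>N\<close>, as a proper decomposition requires.\<close>
  have "i0 \<in> set xs" "j0 \<in> set ys" using P by (auto simp: xs_def ys_def)
  then have km0: "0 < k" "0 < m" by (auto simp: k_def m_def)
  have "distinct (xs @ ys)" by (auto simp: xs_def ys_def)
  then have inj: "inj_on p {..<N}"
    using km by (auto simp: p_def inj_on_def nth_eq_iff_index_eq k_def m_def)
  have "set (xs @ ys) = {..<N}" by (auto simp: xs_def ys_def)
  then have range: "p j < N" if "j < N" for j
    using that km nth_mem[of j "xs @ ys"] by (auto simp: p_def k_def m_def)
  have Pp: "P (p j) \<longleftrightarrow> j < k" if "j < N" for j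
  proof (cases "j < k")
    case True
    then have "p j \<in> set xs" by (simp add: p_def k_def nth_append)
    then show ?thesis using True by (simp add: xs_def)
  next
    case False
    then have "p j \<in> set ys" using that km by (simp add: p_def k_def m_def nth_append)
    then show ?thesis using False by (simp add: ys_def)
  qed
  define sel where "sel r q = mat N r (\<lambda>(i, j). S $$ (i, q j))" for r and q :: "nat \<Rightarrow> nat"
  have sel: "sel r q \<in> carrier_mat N r" for r q by (simp add: sel_def)
  have q_inj: "inj_on (\<lambda>j. p (k + j)) {..<m}"
    using km by (auto intro!: inj_onI dest!: inj_onD[OF inj])
  \<comment> \<open>\<open>W1\<close> uses the first \<open>k\<close> columns in the new order,
    \<open>W2\<close> the remaining \<open>m\<close>; hence the offset \<open>k + j\<close>.\<close>
  define W1 W2 where "W1 x = mat_adjoint (sel k p) * W x * sel k p"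
    and "W2 x = mat_adjoint (sel m (\<lambda>j. p (k + j))) * W x * sel m (\<lambda>j. p (k + j))" for x
  have W1: "matrix_weight a b k W1"
    unfolding W1_def using inj range km
    by (intro matrix_weight_congruence[OF W sel, of "mat k N (\<lambda>(l, i). S' $$ (p l, i))"] km0
        column_selection_left_inverse[OF S, folded sel_def])
      (auto intro: inj_on_subset)
  have W2: "matrix_weight a b m W2"
    unfolding W2_def using q_inj range km
    by (intro matrix_weight_congruence[OF W sel, of "mat m N (\<lambda>(l, i). S' $$ (p (k + l), i))"] km0
        column_selection_left_inverse[OF S, folded sel_def])
      auto
  have W12c: "W1 x \<in> carrier_mat k k" "W2 x \<in> carrier_mat m m" for x
    using matrix_weight_carrier[OF W1] matrix_weight_carrier[OF W2] by auto
  \<comment> \<open>\<open>T\<close> is \<open>S\<close> with its columns reordered by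
    \<open>p\<close>; its adjoint is the constant matrix realizing the equivalence.\<close>
  define T where "T = sel N p"
  have T: "T \<in> carrier_mat N N" by (simp add: T_def sel)
  define L where "L = mat N N (\<lambda>(l, i). S' $$ (p l, i))"
  have L: "L \<in> carrier_mat N N" by (simp add: L_def)
  have LT: "L * T = 1\<^sub>m N"
    unfolding L_def T_def sel_def using inj range by (intro column_selection_left_inverse[OF S]) auto
  have "mat_adjoint (1\<^sub>m N) = (1\<^sub>m N :: complex mat)"
    by (rule eq_matI) auto
  then have "mat_adjoint T * mat_adjoint L = 1\<^sub>m N"
    using LT mat_adjoint_mult[OF L T] by simp
  moreover from this have "mat_adjoint L * mat_adjoint T = 1\<^sub>m N"
    by (intro mat_mult_left_right_inverse[OF _ _ \<open>mat_adjoint T * mat_adjoint L = 1\<^sub>m N\<close>])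
      (use T L in auto)
  ultimately have inv: "invertible_mat (mat_adjoint T)"
    unfolding invertible_mat_def inverts_mat_def using T L
    by (intro conjI exI[of _ "mat_adjoint L"]) auto
  have "AE x in lebesgue. direct_sum [W1, W2] x = mat_adjoint T * W x * mat_adjoint (mat_adjoint T)"
    using zero
  proof eventually_elim
    case (elim x)
    note W1c = W12c(1)[of x] and W2c = W12c(2)[of x]
    have ds: "direct_sum [W1, W2] x = four_block_mat (W1 x) (0\<^sub>m k m) (0\<^sub>m m k) (W2 x)"
      using W1c W2c
      by (simp add: direct_sum_def Let_def diag_block_mat.simps(2)[of "W1 x" "[W2 x]"] del: diag_block_mat.simps)
    show ?case
    proof (rule eq_matI)
      fix i j assume "i < dim_row (mat_adjoint T * W x * mat_adjoint (mat_adjoint T))"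
        "j < dim_col (mat_adjoint T * W x * mat_adjoint (mat_adjoint T))"
      then have ij: "i < N" "j < N" using T by auto
      have full: "(mat_adjoint T * W x * T) $$ (i, j) = (mat_adjoint S * W x * S) $$ (p i, p j)"
        unfolding T_def sel_def using range ij by (intro column_selection_congruence[OF S(1) Wc]) auto
      have upper: "W1 x $$ (i, j) = (mat_adjoint S * W x * S) $$ (p i, p j)" if "i < k" "j < k"
        unfolding W1_def sel_def using range that km
        by (intro column_selection_congruence[OF S(1) Wc]) auto
      have lower: "W2 x $$ (i - k, j - k) = (mat_adjoint S * W x * S) $$ (p i, p j)"
        if "\<not> i < k" "\<not> j < k"
        using column_selection_congruence[OF S(1) Wc[of x], where p = "\<lambda>j. p (k + j)" and k = m
            and i = "i - k" and j = "j - k"] range that km ij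
        unfolding W2_def sel_def by (simp add: image_subset_iff)
      \<comment> \<open>By \<open>Pp\<close>, the indices \<open>i\<close> and \<open>j\<close> lie
        in different blocks exactly when \<open>P\<close> distinguishes \<open>p i\<close> from
        \<open>p j\<close>, which is the case covered by \<open>zero\<close>.\<close>
      have mixed: "(mat_adjoint S * W x * S) $$ (p i, p j) = 0" if "(i < k) \<noteq> (j < k)"
        using elim that range ij Pp by simp
      show "direct_sum [W1, W2] x $$ (i, j) = (mat_adjoint T * W x * mat_adjoint (mat_adjoint T)) $$ (i, j)"
        unfolding ds mat_adjoint_adjoint full using upper lower mixed W1c W2c ij km
        by (cases "i < k"; cases "j < k") auto
    qed (use W1c W2c T km ds in auto)
  qed
  then have "equivalent_weights N W (direct_sum [W1, W2])"
    unfolding equivalent_weights_def using inv T by (intro bexI[of _ "mat_adjoint T"]) auto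
  moreover have "\<forall>w\<in>set [W1, W2]. \<exists>n<N. matrix_weight a b n w"
    using W1 W2 km km0 by (auto intro: exI[of _ k] exI[of _ m])
  ultimately show ?thesis unfolding irreducible_weight_def by blast
qed

theorem theorem4p12:
  fixes N :: nat and a b c d :: ereal
    and W V :: "real \<Rightarrow> complex mat"
    and Q :: "nat \<Rightarrow> complex poly mat"
  assumes "matrix_weight a b N W" and "irreducible_weight a b N W" and "compact_support N W"
    and "matrix_weight c d N V" and "compact_support N V"
    and "orthogonal_polynomials N W Q"
    and "orthogonal_polynomials N V Q"
  shows "\<exists>l::real. l > 0 \<and> (AE x in lebesgue. V x = complex_of_real l \<cdot>\<^sub>m W x)"
proof -
  note W = assms(1) and V = assms(4)
  note Wc = matrix_weight_carrier[OF W]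
  define W0 V0 where "W0 = mat_integral N W" and "V0 = mat_integral N V"
  have W0: "pos_definite N W0" and V0: "pos_definite N V0"
    using W V by (simp_all add: W0_def V0_def pos_definite_mat_integral)
  then have W0c: "W0 \<in> carrier_mat N N" and V0c: "V0 \<in> carrier_mat N N"
    by (simp_all add: pos_definite_def)
  obtain B where B: "B \<in> carrier_mat N N" "W0 * B = 1\<^sub>m N"
    using pos_definite_inverse[OF W0] by blast
  define M where "M = B * V0"
  have M: "M \<in> carrier_mat N N" unfolding M_def using B(1) V0c by (rule mult_carrier_mat)
  have V0_eq: "V0 = W0 * M"
    unfolding M_def assoc_mult_mat[OF W0c B(1) V0c, symmetric] B(2) using V0c by simp
  have VWM: "AE x in lebesgue. V x = W x * M"
    using weight_eq_mult_constant[OF W assms(3,6) V assms(5,7) M] V0_eq by (simp add: V0_def W0_def)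
  \<comment> \<open>Both sides are \<open>V0\<close>: the right-hand side is the adjoint of
    \<open>W0 * M\<close>, and \<open>V0\<close> and \<open>W0\<close> are Hermitian.\<close>
  have "W0 * M = mat_adjoint M * W0"
    using V0 W0 mat_adjoint_mult[OF W0c M] by (simp add: V0_eq pos_definite_def)
  from selfadjoint_diagonalizable[OF W0 M this] obtain S S' and e :: "nat \<Rightarrow> real"
    where S: "S \<in> carrier_mat N N" "S' \<in> carrier_mat N N" "S * S' = 1\<^sub>m N" "S' * S = 1\<^sub>m N"
      and diag: "M * S = S * mat N N (\<lambda>(i, j). if i = j then complex_of_real (e i) else 0)" .
  define D where "D = mat N N (\<lambda>(i, j). if i = j then complex_of_real (e i) else 0)"
  have D: "D \<in> carrier_mat N N" by (simp add: D_def)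
  have MS: "M * S = S * D" using diag by (simp add: D_def)
  have e_const: "e i = e j" if ij: "i < N" "j < N" for i j
  proof (rule ccontr)
    assume "e i \<noteq> e j"
    \<comment> \<open>The indices are split according to whether they belong to the eigenvalue
      \<open>e i\<close>. The index \<open>i\<close> lies on one side and \<open>j\<close> on the
      other.\<close>
    have "AE x in lebesgue. \<forall>k<N. \<forall>l<N. (e k = e i) \<noteq> (e l = e i) \<longrightarrow>
        (mat_adjoint S * W x * S) $$ (k, l) = 0"
      using VWM
    proof eventually_elim
      case (elim x)
      note assoc = assoc_mult_mat[of _ N N _ N _ N]
      have adj: "mat_adjoint S \<in> carrier_mat N N" "mat_adjoint M \<in> carrier_mat N N"
        "mat_adjoint D \<in> carrier_mat N N" using S M D by auto
      \<comment> \<open>Obtained from \<open>V x = W x * M\<close> by taking adjoints, at each point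
        where this equation holds.\<close>
      have WM: "W x * M = mat_adjoint M * W x"
        using elim matrix_weight_adjoint[OF V, of x] matrix_weight_adjoint[OF W, of x]
          mat_adjoint_mult[OF Wc[of x] M] by simp
      have SM: "mat_adjoint S * mat_adjoint M = mat_adjoint D * mat_adjoint S"
        using MS mat_adjoint_mult[OF M S(1)] mat_adjoint_mult[OF S(1) D] by simp
      define K where "K = mat_adjoint S * W x * S"
      have K: "K \<in> carrier_mat N N"
        unfolding K_def using adj(1) Wc[of x] S(1) by (intro mult_carrier_mat)
      have "K * D = mat_adjoint S * W x * (S * D)"
        unfolding K_def using S(1) D Wc[of x] adj mult_carrier_mat[OF adj(1) Wc[of x]] by (simp add: assoc)
      also have "\<dots> = mat_adjoint S * (W x * M) * S"
        unfolding MS[symmetric] using S(1) M Wc[of x] adj by (simp add: assoc)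
      also have "\<dots> = (mat_adjoint S * mat_adjoint M) * W x * S"
        unfolding WM using S(1) M Wc[of x] adj by (simp add: assoc)
      also have "\<dots> = mat_adjoint D * K"
        unfolding SM K_def using S(1) D Wc[of x] adj
          assoc[of "mat_adjoint D" "mat_adjoint S * W x" S] mult_carrier_mat[OF adj(1) Wc[of x]]
        by (simp add: assoc)
      finally have KD: "K * D = mat_adjoint D * K" .
      \<comment> \<open>The entry \<open>(k, l)\<close> of \<open>KD\<close> reads
        \<open>K $$ (k, l) * e l = e k * K $$ (k, l)\<close>; no conjugate remains on
        \<open>e k\<close> because the eigenvalues are real.\<close>
      have "K $$ (k, l) = 0" if kl: "k < N" "l < N" "e k \<noteq> e l" for k l
      proof -
        have "(K * D) $$ (k, l) = K $$ (k, l) * e l"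
          using K kl by (simp add: D_def scalar_prod_def atLeast0LessThan if_distrib sum.delta cong: if_cong)
        moreover have "(mat_adjoint D * K) $$ (k, l) = e k * K $$ (k, l)"
          using K kl by (simp add: D_def scalar_prod_def atLeast0LessThan if_distrib
              if_distribR sum.delta cong: if_cong)
        ultimately show ?thesis using KD kl(3) by simp
      qed
      then show ?case unfolding K_def by metis
    qed
    from not_irreducible_if_entries_vanish[OF W S(1,2,4) ij(1) refl ij(2) _ this]
    show False using assms(2) \<open>e i \<noteq> e j\<close> by simp
  qed
  have N: "0 < N" using W by (simp add: matrix_weight_def)
  \<comment> \<open>The index 0 is admissible since \<open>N\<close> is positive; by
    \<open>e_const\<close> any other index gives the same value.\<close>
  define l where "l = e 0"
  have "D = complex_of_real l \<cdot>\<^sub>m 1\<^sub>m N"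
    unfolding D_def l_def by (intro eq_matI) (auto intro: e_const[OF _ N])
  then have MS_l: "M * S = complex_of_real l \<cdot>\<^sub>m S"
    using MS S(1) by (simp add: mult_smult_distrib[OF S(1) one_carrier_mat])
  have "M = M * S * S'"
    using assoc_mult_mat[OF M S(1,2)] S(3) M by simp
  then have M_l: "M = complex_of_real l \<cdot>\<^sub>m 1\<^sub>m N"
    unfolding MS_l mult_smult_assoc_mat[OF S(1,2)] S(3) .
  have mult_M: "A * M = complex_of_real l \<cdot>\<^sub>m A" if "A \<in> carrier_mat N N" for A
    unfolding M_l using that by (simp add: mult_smult_distrib[OF that one_carrier_mat])
  \<comment> \<open>The sign of \<open>l\<close> is found by comparing diagonal entries of the
    zeroth moments, both positive.\<close>
  have "V0 $$ (0, 0) = complex_of_real l * W0 $$ (0, 0)"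
    using V0_eq mult_M[OF W0c] W0c N by simp
  then have "0 < l"
    using pos_definite_diag[OF W0 N] pos_definite_diag[OF V0 N]
    by (auto simp: less_complex_def zero_less_mult_iff)
  moreover have "AE x in lebesgue. V x = complex_of_real l \<cdot>\<^sub>m W x"
    using VWM by eventually_elim (use mult_M Wc in simp)
  ultimately show ?thesis by blast
qed

end
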